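(* Let $0<\alpha<1$ and let $n\geq 1$ be an integer. Suppose that $f(z)$ is an analytic function in a complex domain $D$ containing the closed interval $[0,1]$ in its interior. Then $$\mathrm{f.p.}\int_0^1 x^{\alpha-1-n}f(x)\,\mathrm{d}x=\frac{1}{2\pi\mathrm{i}}\oint_C z^{-n}f(z)\Psi_{\alpha}(z)\,\mathrm{d}z+\sum_{k=0}^{n-1}\frac{f^{(k)}(0)}{k!\,(\alpha-n+k)},$$ where $$\Psi_{\alpha}(z)=\alpha^{-1}z^{-1}F(\alpha,1;\alpha+1;z^{-1}),$$ and $C$ is a closed complex integral path contained in $D\setminus[0,1]$ and encircling the interval $[0,1]$ in the positive sense.
   Context: For $0<\alpha<1$, an integer $n\geq 1$ and a function $f$ analytic on the closed interval $[0,1]$, the Hadamard finite-part integral is defined by $$\mathrm{f.p.}\int_0^1 x^{\alpha-1-n}f(x)\,\mathrm{d}x=\lim_{\epsilon\downarrow 0}\left\{\int_{\epsilon}^1 x^{\alpha-1-n}f(x)\,\mathrm{d}x-\sum_{k=0}^{n-1}\frac{\epsilon^{\alpha-n+k}}{k!\,(n-k-\alpha)}f^{(k)}(0)\right\}.$$ $F(a,b;c;w)$ denotes the Gauss hypergeometric function ${}_2F_1$, i.e. $\sum_{k\geq 0}\frac{(a)_k(b)_k}{(c)_k k!}w^k$ for $|w|<1$ (with $(a)_0=1$, $(a)_k=a(a+1)\cdots(a+k-1)$), analytically continued to $\mathbb{C}\setminus[1,\infty)$ (principal branch); hence $\Psi_\alpha$ is a single-valued analytic function on $\mathbb{C}\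setminus[0,1]$.
   Formalization: The path C is additionally required not to wind around any point outside D (winding number 0 there); without this the formula fails, e.g. for f(z)=1/(z-2), D the plane without 2, and C the circle |z|=3. *)

theory Defs
  imports "HOL-Complex_Analysis.Complex_Analysis"
begin

definition gauss_series :: "complex \<Rightarrow> complex \<Rightarrow> complex \<Rightarrow> complex \<Rightarrow> complex" where
  "gauss_series a b c w =
     (\<Sum>k. pochhammer a k * pochhammer b k / (pochhammer c k * fact k) * w ^ k)"

definition slit_plane :: "complex set" where
  "slit_plane = - (complex_of_real ` {1..})"

(* The analytic continuation of the series from the unit disc to the slit plane. It is unique
   there (gauss_2F1_eqI below); on the slit itself the value is unspecified. *)
definition gauss_2F1 :: "complex \<Rightarrow> complex \<Rightarrow> complex \<Rightarrow> complex \<Rightarrow> complex" where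
  "gauss_2F1 a b c =
     (SOME F. F holomorphic_on slit_plane \<and> (\<forall>w\<in>ball 0 1. F w = gauss_series a b c w))"

lemma open_slit_plane: "open slit_plane"
proof -
  have "closed (complex_of_real ` {1..})"
    by (rule closed_injective_linear_image) (auto simp: linear_iff scaleR_conv_of_real intro: inj_onI)
  then show ?thesis by (simp add: slit_plane_def open_Compl)
qed

lemma ball_subset_slit_plane: "ball 0 1 \<subseteq> slit_plane"
  by (auto simp: slit_plane_def)

lemma connected_slit_plane: "connected slit_plane"
proof (rule starlike_imp_connected, unfold starlike_def, intro bexI ballI)
  show "0 \<in> slit_plane" by (auto simp: slit_plane_def)
  fix x assume x: "x \<in> slit_plane"
  show "closed_segment 0 x \<subseteq> slit_plane"
  proof
    fix y assume "y \<in> closed_segment 0 x"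
    then obtain u where u: "0 \<le> u" "u \<le> 1" "y = u *\<^sub>R x"
      by (auto simp: in_segment)
    have False if "r \<ge> 1" "y = complex_of_real r" for r
    proof -
      have "u \<noteq> 0" using that u by auto
      then have "x = complex_of_real (r / u)"
        using that u by (auto simp: scaleR_conv_of_real field_simps)
      moreover have "r / u \<ge> 1" using that u \<open>u \<noteq> 0\<close> by (simp add: field_simps)
      ultimately show False using x unfolding slit_plane_def by blast
    qed
    then show "y \<in> slit_plane" by (auto simp: slit_plane_def)
  qed
qed

lemma gauss_2F1_eqI:
  assumes F: "F holomorphic_on slit_plane"
    and eq: "\<And>w. w \<in> ball 0 1 \<Longrightarrow> F w = gauss_series a b c w"
    and w: "w \<in> slit_plane"
  shows "gauss_2F1 a b c w = F w"
proof -
  let ?P = "\<lambda>F. F holomorphic_on slit_plane \<and> (\<forall>w\<in>ball 0 1. F w = gauss_series a b c w)"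
  have G: "?P (gauss_2F1 a b c)"
    unfolding gauss_2F1_def by (rule someI[of ?P F]) (use F eq in blast)
  show ?thesis
    by (rule analytic_continuation_open[of "ball 0 1" slit_plane])
       (use G F eq w open_slit_plane connected_slit_plane ball_subset_slit_plane in auto)
qed

definition Psi :: "real \<Rightarrow> complex \<Rightarrow> complex" where
  "Psi \<alpha> z = inverse (of_real \<alpha>) * inverse z
              * gauss_2F1 (of_real \<alpha>) 1 (of_real \<alpha> + 1) (inverse z)"

(* "f.p. integral of x^(alpha-1-n) f(x) over [0,1] exists and equals I" *)
definition has_finite_part_integral ::
    "real \<Rightarrow> nat \<Rightarrow> (complex \<Rightarrow> complex) \<Rightarrow> complex \<Rightarrow> bool" where
  "has_finite_part_integral \<alpha> n f I \<longleftrightarrow>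
     ((\<lambda>\<epsilon>. integral {\<epsilon>..1} (\<lambda>x. of_real (x powr (\<alpha> - 1 - real n)) * f (of_real x))
            - (\<Sum>k<n. of_real (\<epsilon> powr (\<alpha> - real n + real k)
                              / (fact k * (real n - real k - \<alpha>)))
                      * (deriv ^^ k) f 0))
       \<longlongrightarrow> I) (at_right 0)"

definition finite_part_integral :: "real \<Rightarrow> nat \<Rightarrow> (complex \<Rightarrow> complex) \<Rightarrow> complex" where
  "finite_part_integral \<alpha> n f = (THE I. has_finite_part_integral \<alpha> n f I)"

lemma finite_part_integral_eqI:
  assumes "has_finite_part_integral \<alpha> n f I"
  shows "finite_part_integral \<alpha> n f = I"
  unfolding finite_part_integral_def
  by (rule the_equality[where P = "has_finite_part_integral \<alpha> n f", OF assms])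
     (use assms in \<open>auto simp: has_finite_part_integral_def
        intro: tendsto_unique[OF trivial_limit_at_right_real]\<close>)

end

(* Euler's integral gives Psi z as the integral of x^(alpha-1)/(z - x) over [0,1]. Write f as its
   Taylor polynomial of degree < n at 0 plus z^n g(z). After interchanging the two integrals, the
   Taylor part contributes z^(k-n)/(z - x) with k < n, whose residues at 0 and x cancel, while
   Cauchy's formula applied to g leaves the convergent integral of x^(alpha-1) g(x). The same
   decomposition on the real side splits the integral over [eps,1] into explicit powers, which
   yield the counterterms and the finite sum, and an integral converging to that of
   x^(alpha-1) g(x). *)

theory Submission imports Defs begin

section \<open>Euler's integral for the hypergeometric function\<close>

text \<open>Here (1)_k cancels k!, and a (a+1)_k = (a)_k (a+k), both sides being (a)_(k+1).
  Positivity of Re a keeps all denominators nonzero.\<close>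

lemma gauss_coefficient:
  fixes a :: complex
  assumes "0 < Re a"
  shows "pochhammer a k * pochhammer 1 k / (pochhammer (a + 1) k * fact k) = a / (a + of_nat k)"
proof -
  have nz: "pochhammer (a + 1) k \<noteq> 0"
  proof
    assume "pochhammer (a + 1) k = 0"
    then obtain j where "a + 1 = - of_nat j" by (auto simp: pochhammer_eq_0_iff)
    then have "Re (a + 1) = Re (- of_nat j)" by (rule arg_cong)
    with assms show False by simp
  qed
  have "Re (a + of_nat k) \<noteq> 0" using assms by simp
  then have "a + of_nat k \<noteq> 0" by (metis zero_complex.sel(1))
  moreover have "a * pochhammer (a + 1) k = (a + of_nat k) * pochhammer a k"
    by (simp flip: pochhammer_rec pochhammer_rec')
  ultimately show ?thesis
    using nz by (simp add: pochhammer_fact[symmetric] field_simps)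
qed

lemma slit_plane_denominator_nonzero:
  assumes "w \<in> slit_plane" "x \<in> {0..1::real}"
  shows "1 - w * of_real x \<noteq> 0"
proof
  assume *: "1 - w * of_real x = 0"
  then have "x \<noteq> 0" by auto
  with * have "w = of_real (1 / x)" by (simp add: field_simps)
  moreover have "1 / x \<ge> 1" using assms(2) \<open>x \<noteq> 0\<close> by simp
  ultimately show False using assms(1) unfolding slit_plane_def by blast
qed

lemma powr_unit_interval:
  fixes t \<beta> :: real
  assumes "t \<in> {0..1}" "\<beta> > 0"
  shows "t powr \<beta> \<in> {0..1}"
  using assms powr_mono2[of \<beta> t 1] by auto

context
  fixes \<beta> :: real
  assumes \<beta>: "\<beta> > 0"
begin

lemma continuous_on_powr_unit: "continuous_on {0..1} (\<lambda>t::real. t powr \<beta>)"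
  using \<beta> by (intro continuous_on_powr') (auto intro: continuous_intros)

text \<open>Differentiation under the integral sign. The Leibniz rule asks for a convex domain,
  which the slit plane is not, so it is applied on a small ball around each point. The exponent
  \<open>\<beta>\<close> will be 1/alpha.\<close>

lemma euler_integral_holomorphic:
  "(\<lambda>w. integral {0..1} (\<lambda>t. 1 / (1 - w * of_real (t powr \<beta>)))) holomorphic_on slit_plane"
proof (rule holomorphic_onI)
  fix w0 assume "w0 \<in> slit_plane"
  then obtain r where r: "r > 0" "ball w0 r \<subseteq> slit_plane"
    using open_slit_plane openE by blast
  have nz: "1 - w * of_real (t powr \<beta>) \<noteq> 0" if "w \<in> ball w0 r" "t \<in> {0..1}" for w t
    using slit_plane_denominator_nonzero[of w "t powr \<beta>"] powr_unit_interval[OF that(2) \<beta>] r that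
    by blast
  have "(\<lambda>w. integral (cbox 0 1) (\<lambda>t. 1 / (1 - w * of_real (t powr \<beta>)))) holomorphic_on ball w0 r"
  proof (rule leibniz_rule_holomorphic)
    fix w t assume wt: "w \<in> ball w0 r" "t \<in> cbox 0 (1::real)"
    show "((\<lambda>w. 1 / (1 - w * of_real (t powr \<beta>))) has_field_derivative
            of_real (t powr \<beta>) / (1 - w * of_real (t powr \<beta>))\<^sup>2) (at w within ball w0 r)"
      using nz[of w t] wt
      by (auto intro!: derivative_eq_intros simp: power2_eq_square)
  next
    fix w assume w: "w \<in> ball w0 r"
    show "(\<lambda>t. 1 / (1 - w * of_real (t powr \<beta>))) integrable_on cbox 0 1"
      using nz[OF w] unfolding cbox_interval
      by (intro integrable_continuous_real continuous_intros continuous_on_powr_unit) auto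
  next
    have c: "continuous_on (ball w0 r \<times> {0..1}) (\<lambda>x. snd x powr \<beta>)"
      by (rule continuous_on_compose2[OF continuous_on_powr_unit])
        (auto intro: continuous_intros)
    show "continuous_on (ball w0 r \<times> cbox 0 1)
        (\<lambda>(w, t). of_real (t powr \<beta>) / (1 - w * of_real (t powr \<beta>))\<^sup>2)"
      unfolding cbox_interval split_beta using nz
      by (intro continuous_intros c) auto
  qed auto
  then have "(\<lambda>w. integral {0..1} (\<lambda>t. 1 / (1 - w * of_real (t powr \<beta>)))) holomorphic_on ball w0 r"
    by simp
  then show "(\<lambda>w. integral {0..1} (\<lambda>t. 1 / (1 - w * of_real (t powr \<beta>))))
      field_differentiable at w0 within slit_plane"
    using holomorphic_on_imp_differentiable_at[of _ "ball w0 r" w0] r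
    by (auto intro: field_differentiable_at_within)
qed

text \<open>The kernel is a geometric series in w t^beta. It converges uniformly on [0,1], being
  dominated by the powers of |w| < 1, so it may be integrated term by term.\<close>

lemma euler_integral_sums:
  fixes w :: complex
  assumes w: "w \<in> ball 0 1"
  shows "(\<lambda>k. w ^ k / of_real (1 + \<beta> * real k)) sums
           integral {0..1} (\<lambda>t. 1 / (1 - w * of_real (t powr \<beta>)))"
proof -
  have w1: "norm w < 1" using w by simp
  have bound: "norm (w * of_real (t powr \<beta>)) \<le> norm w" if "t \<in> {0..1}" for t
    using powr_unit_interval[OF that \<beta>] by (simp add: norm_mult mult_left_le)
  let ?S = "\<lambda>N t. \<Sum>k<N. (w * of_real (t powr \<beta>)) ^ k"
  have "uniform_limit {0..1} ?S (\<lambda>t. \<Sum>k. (w * of_real (t powr \<beta>)) ^ k) sequentially"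
    using bound w1
    by (intro Weierstrass_m_test[where M = "\<lambda>k. norm w ^ k"] summable_geometric)
       (auto simp: norm_power intro!: power_mono)
  moreover have "(\<Sum>k. (w * of_real (t powr \<beta>)) ^ k) = 1 / (1 - w * of_real (t powr \<beta>))"
    if "t \<in> {0..1}" for t
    using bound[OF that] w1 by (intro suminf_geometric) linarith
  ultimately have ul: "uniform_limit {0..1} ?S (\<lambda>t. 1 / (1 - w * of_real (t powr \<beta>))) sequentially"
    by (elim uniform_limit_cong'[THEN iffD1, rotated 2]) simp_all
  have "continuous_on {0..1} (?S N)" for N
    by (intro continuous_intros continuous_on_powr_unit)
  then obtain I J where IJ: "\<And>N. (?S N has_integral I N) {0..1}"
      "((\<lambda>t. 1 / (1 - w * of_real (t powr \<beta>))) has_integral J) {0..1}" "I \<longlonglongrightarrow> J"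
    using uniform_limit_integral[OF ul] by auto
  have summand: "((\<lambda>t. (w * of_real (t powr \<beta>)) ^ k) has_integral w ^ k / of_real (1 + \<beta> * real k)) {0..1}" for k
  proof -
    have "((\<lambda>t. t powr (\<beta> * real k)) has_integral 1 powr (\<beta> * real k + 1) / (\<beta> * real k + 1)) {0..1}"
      using \<beta> by (intro has_integral_powr_from_0) (auto intro: less_le_trans[of _ 0])
    then have "((\<lambda>t. t powr (\<beta> * real k)) has_integral 1 / (1 + \<beta> * real k)) {0..1}"
      by (simp add: add.commute)
    then have "((\<lambda>t. w ^ k * of_real (t powr (\<beta> * real k))) has_integral
        w ^ k * of_real (1 / (1 + \<beta> * real k))) {0..1}"
      by (intro has_integral_mult_right has_integral_of_real)
    then show ?thesis
    \<comment> \<open>The point t = 0 is removed because of the term k = 0: there the left-hand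
      power is 0^0 = 1, whereas \<open>0 powr 0\<close> is 0.\<close>
    proof (rule has_integral_spike_finite[where S = "{0}", rotated 2, THEN has_integral_eq_rhs])
      fix t :: real assume "t \<in> {0..1} - {0}"
      then show "(w * of_real (t powr \<beta>)) ^ k = w ^ k * of_real (t powr (\<beta> * real k))"
        by (simp add: power_mult_distrib powr_powr[symmetric] powr_realpow flip: of_real_power)
    qed auto
  qed
  have "I = (\<lambda>N. \<Sum>k<N. w ^ k / of_real (1 + \<beta> * real k))"
    by (rule ext, rule has_integral_unique[OF IJ(1)]) (intro has_integral_sum summand; simp)
  with IJ(3) show ?thesis by (simp only: sums_def integral_unique[OF IJ(2)])
qed

end

text \<open>Euler's integral for the hypergeometric function, with \<open>x = t powr (1 / \<alpha>)\<close> substituted to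
  remove the singularity of \<open>x powr (\<alpha> - 1)\<close>.\<close>

lemma gauss_2F1_euler:
  assumes "0 < \<alpha>" and w: "w \<in> slit_plane"
  shows "gauss_2F1 (of_real \<alpha>) 1 (of_real \<alpha> + 1) w =
           integral {0..1} (\<lambda>t. 1 / (1 - w * of_real (t powr (1 / \<alpha>))))"
proof (rule gauss_2F1_eqI[OF _ _ w])
  have \<beta>: "1 / \<alpha> > 0" using assms by simp
  show "(\<lambda>w. integral {0..1} (\<lambda>t. 1 / (1 - w * of_real (t powr (1 / \<alpha>))))) holomorphic_on slit_plane"
    by (rule euler_integral_holomorphic[OF \<beta>])
  fix v :: complex assume v: "v \<in> ball 0 1"
  \<comment> \<open>Dividing through by alpha brings the hypergeometric coefficient into the form
    produced by termwise integration with exponent 1/alpha.\<close>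
  have "of_real \<alpha> / (of_real \<alpha> + of_nat k) * v ^ k = v ^ k / of_real (1 + 1 / \<alpha> * real k)" for k
  proof -
    have "\<alpha> / (\<alpha> + real k) = 1 / (1 + 1 / \<alpha> * real k)"
      using assms by (simp add: field_simps)
    then have "complex_of_real (\<alpha> / (\<alpha> + real k)) = of_real (1 / (1 + 1 / \<alpha> * real k))"
      by (rule arg_cong)
    then have "of_real \<alpha> / (of_real \<alpha> + of_nat k) = 1 / complex_of_real (1 + 1 / \<alpha> * real k)"
      by simp
    then show ?thesis by simp
  qed
  then have "gauss_series (of_real \<alpha>) 1 (of_real \<alpha> + 1) v = (\<Sum>k. v ^ k / of_real (1 + 1 / \<alpha> * real k))"
    unfolding gauss_series_def using assms by (simp add: gauss_coefficient)
  then show "integral {0..1} (\<lambda>t. 1 / (1 - v * of_real (t powr (1 / \<alpha>)))) =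
      gauss_series (of_real \<alpha>) 1 (of_real \<alpha> + 1) v"
    using euler_integral_sums[OF \<beta> v] by (simp add: sums_iff)
qed

section \<open>Psi off the unit interval, and the interchange of integrals\<close>

lemma inverse_in_slit_plane:
  assumes "z \<notin> complex_of_real ` {0..1}"
  shows "inverse z \<in> slit_plane"
proof -
  have False if "r \<ge> 1" "inverse z = of_real r" for r
  proof -
    have "z = of_real (1 / r)" using that by (metis inverse_eq_divide inverse_inverse_eq of_real_inverse)
    moreover have "1 / r \<in> {0..1}" using that by simp
    ultimately show False using assms by blast
  qed
  then show ?thesis by (auto simp: slit_plane_def)
qed

text \<open>The factor 1/z in \<open>Psi\<close> turns the kernel 1/(1 - x/z) into 1/(z - x). With t
  = x^alpha, dt = alpha x^(alpha-1) dx, the right-hand side is the integral of x^(alpha-1)/(z - x)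
  over [0,1].\<close>

lemma Psi_eq_integral:
  assumes "0 < \<alpha>" "z \<notin> complex_of_real ` {0..1}"
  shows "Psi \<alpha> z = 1 / of_real \<alpha> * integral {0..1} (\<lambda>t. 1 / (z - of_real (t powr (1 / \<alpha>))))"
proof -
  have "z \<noteq> 0" using assms by force
  then have "inverse z * (1 / (1 - inverse z * y)) = 1 / (z - y)" for y
    by (simp add: field_simps)
  then show ?thesis
    using assms inverse_in_slit_plane
    by (simp add: Psi_def gauss_2F1_euler inverse_eq_divide mult.assoc
        flip: integral_mult_right)
qed

text \<open>Euler's integral shows that the continuation chosen in \<open>gauss_2F1\<close> exists
  and is holomorphic. Inversion carries the complement of [0,1] into the slit plane, and it is
  holomorphic there because 0 belongs to the interval.\<close>

lemma Psi_holomorphic: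
  assumes "0 < \<alpha>"
  shows "Psi \<alpha> holomorphic_on - complex_of_real ` {0..1}"
proof -
  have "gauss_2F1 (of_real \<alpha>) 1 (of_real \<alpha> + 1) holomorphic_on slit_plane"
    using euler_integral_holomorphic[of "1 / \<alpha>"] gauss_2F1_euler assms
    by (simp cong: holomorphic_cong)
  then have "(gauss_2F1 (of_real \<alpha>) 1 (of_real \<alpha> + 1) \<circ> inverse) holomorphic_on - complex_of_real ` {0..1}"
    by (rule holomorphic_on_compose_gen[rotated])
       (use inverse_in_slit_plane in \<open>force intro!: holomorphic_intros\<close>)+
  then show ?thesis
    unfolding Psi_def o_def by (intro holomorphic_intros) force+
qed

text \<open>The library interchanges contour integrals only along paths with continuous derivative, so
  the contour is first replaced by a nearby polynomial loop.\<close>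

lemma contour_integral_integral_swap:
  fixes k :: "complex \<Rightarrow> real \<Rightarrow> complex"
  assumes "open S" "valid_path C" "pathfinish C = pathstart C" "path_image C \<subseteq> S"
    and cont: "continuous_on (S \<times> {0..1}) (\<lambda>(z, t). k z t)"
    and hol: "\<And>t. t \<in> {0..1} \<Longrightarrow> (\<lambda>z. k z t) holomorphic_on S"
    and holI: "(\<lambda>z. integral {0..1} (k z)) holomorphic_on S"
  shows "contour_integral C (\<lambda>z. integral {0..1} (k z)) =
         integral {0..1} (\<lambda>t. contour_integral C (\<lambda>z. k z t))"
proof -
  have "path C" using assms by (simp add: valid_path_imp_path)
  \<comment> \<open>Any two loops within distance d of C give the same integral for every function
    holomorphic on S. This is used below with C itself and a polynomial approximation p.\<close>
  obtain d where d: "d > 0" "\<And>g h. \<lbrakk>valid_path g; valid_path h;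
      \<forall>t\<in>{0..1}. norm (g t - C t) < d \<and> norm (h t - C t) < d;
      pathfinish g = pathstart g; pathfinish h = pathstart h\<rbrakk> \<Longrightarrow>
      path_image h \<subseteq> S \<and> (\<forall>f. f holomorphic_on S \<longrightarrow> contour_integral h f = contour_integral g f)"
    using contour_integral_nearby_loops[OF \<open>open S\<close> \<open>path C\<close> \<open>path_image C \<subseteq> S\<close>] by metis
  obtain p where p: "polynomial_function p" "pathstart p = pathstart C" "pathfinish p = pathfinish C"
      "\<And>t. t \<in> {0..1} \<Longrightarrow> norm (p t - C t) < d"
    using path_approx_polynomial_function[OF \<open>path C\<close> \<open>d > 0\<close>] by metis
  have vp: "valid_path p" using p by (simp add: valid_path_polynomial_function)
  have pS: "path_image p \<subseteq> S"
    and eq: "\<And>f. f holomorphic_on S \<Longrightarrow> contour_integral p f = contour_integral C f"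
    using d(2)[OF \<open>valid_path C\<close> vp] p d(1) assms(3) by auto
  obtain p' where p': "polynomial_function p'" "\<And>x. (p has_vector_derivative p' x) (at x)"
    using has_vector_derivative_polynomial_function[OF p(1)] by blast
  \<comment> \<open>The real integral is read as a contour integral along the segment from 0 to 1,
    with \<open>Re\<close> recovering the real parameter, so that
    \<open>contour_integral_swap\<close> applies.\<close>
  have line: "contour_integral (linepath 0 1) h = integral {0..1} (\<lambda>t. h (of_real t))" for h
    by (simp add: contour_integral_integral linepath_def scaleR_conv_of_real)
  have seg: "Re w \<in> {0..1}" if "w \<in> closed_segment 0 (1::complex)" for w
    using that by (auto simp: in_segment)
  have "contour_integral C (\<lambda>z. integral {0..1} (k z)) =
        contour_integral p (\<lambda>z. contour_integral (linepath 0 1) (\<lambda>w. k z (Re w)))"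
    by (simp add: eq[OF holI] line)
  also have "\<dots> = contour_integral (linepath 0 1) (\<lambda>w. contour_integral p (\<lambda>z. k z (Re w)))"
  proof (rule contour_integral_swap)
    show "continuous_on (path_image p \<times> path_image (linepath 0 1)) (\<lambda>(z, w). k z (Re w))"
    proof -
      have "continuous_on (path_image p \<times> path_image (linepath 0 1)) (\<lambda>x. (fst x, Re (snd x)))"
        by (intro continuous_intros)
      moreover have "(\<lambda>x. (fst x, Re (snd x))) ` (path_image p \<times> path_image (linepath 0 1)) \<subseteq> S \<times> {0..1}"
        using pS seg by auto
      ultimately show ?thesis
        using continuous_on_compose2[OF cont] by (fastforce simp: split_beta)
    qed
    show "continuous_on {0..1} (\<lambda>t. vector_derivative p (at t))"
      using p'(1) by (simp add: continuous_on_polymonial_function vector_derivative_at[OF p'(2)])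
  qed (auto simp: vp)
  also have "\<dots> = integral {0..1} (\<lambda>t. contour_integral p (\<lambda>z. k z t))"
    by (simp add: line)
  also have "\<dots> = integral {0..1} (\<lambda>t. contour_integral C (\<lambda>z. k z t))"
    by (rule integral_cong) (simp add: eq hol)
  finally show ?thesis .
qed

section \<open>Taylor remainder and residues\<close>

text \<open>Induction on n, passing from f to its difference quotient at 0, which is again
  holomorphic and whose Taylor coefficients are those of f shifted by one. The identity for f is
  purely algebraic, so it holds at every z, also outside S.\<close>

lemma holomorphic_taylor_remainder:
  assumes "f holomorphic_on S" "open S" "0 \<in> S"
  obtains g where "g holomorphic_on S"
    "\<And>z. f z = (\<Sum>k<n. (deriv ^^ k) f 0 / fact k * z ^ k) + z ^ n * g z"
proof -
  have "\<exists>g. g holomorphic_on S \<and> (\<forall>z. f z = (\<Sum>k<n. (deriv ^^ k) f 0 / fact k * z ^ k) + z ^ n * g z)"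
    using assms(1)
  proof (induction n arbitrary: f)
    case 0
    then show ?case by auto
  next
    case (Suc n)
    define h where "h = (\<lambda>z. if z = 0 then deriv f 0 else (f z - f 0) / (z - 0))"
    have h: "h holomorphic_on S"
      unfolding h_def using Suc.prems assms(2) by (rule pole_lemma_open)
    have fh: "f = (\<lambda>z. f 0 + z * h z)"
      by (auto simp: h_def)
    have coeff: "(deriv ^^ k) h 0 / fact k = (deriv ^^ Suc k) f 0 / fact (Suc k)" for k
    proof -
      have "(deriv ^^ Suc k) f 0 = (deriv ^^ Suc k) (\<lambda>z. f 0 + z * h z) 0"
        using fh by simp
      also have "\<dots> = (deriv ^^ Suc k) (\<lambda>z. f 0) 0 + (deriv ^^ Suc k) (\<lambda>z. z * h z) 0"
        using h assms by (intro higher_deriv_add[of _ S]) (auto intro!: holomorphic_intros)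
      also have "\<dots> = (deriv ^^ Suc k) (\<lambda>z. z * h z) 0"
        by (simp del: funpow.simps)
      also have "\<dots> = (\<Sum>i=0..Suc k. of_nat (Suc k choose i) * (deriv ^^ i) (\<lambda>z. z) 0 * (deriv ^^ (Suc k - i)) h 0)"
        using h assms by (intro higher_deriv_mult[of _ S]) (auto intro!: holomorphic_intros)
      \<comment> \<open>At 0 the identity function and all its derivatives but the first vanish, so
        only i = 1 survives in the Leibniz sum.\<close>
      also have "\<dots> = (\<Sum>i\<in>{1}. of_nat (Suc k choose i) * (deriv ^^ i) (\<lambda>z. z) 0 * (deriv ^^ (Suc k - i)) h 0)"
        by (intro sum.mono_neutral_right) (auto simp del: funpow.simps)
      also have "\<dots> = of_nat (Suc k) * (deriv ^^ k) h 0"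
        by simp
      finally show ?thesis by (simp add: field_simps del: funpow.simps of_nat_Suc)
    qed
    obtain g where g: "g holomorphic_on S"
        "\<And>z. h z = (\<Sum>k<n. (deriv ^^ k) h 0 / fact k * z ^ k) + z ^ n * g z"
      using Suc.IH[OF h] by blast
    have "f z = (\<Sum>k<Suc n. (deriv ^^ k) f 0 / fact k * z ^ k) + z ^ Suc n * g z" for z
    proof -
      have "f z = f 0 + z * h z" using fh by metis
      also have "z * h z = (\<Sum>k<n. (deriv ^^ Suc k) f 0 / fact (Suc k) * z ^ Suc k) + z ^ Suc n * g z"
        by (subst g(2)) (simp add: coeff algebra_simps sum_distrib_left del: funpow.simps fact_Suc)
      finally show ?thesis
        by (simp add: sum.lessThan_Suc_shift del: funpow.simps(2) fact_Suc sum.lessThan_Suc)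
    qed
    with g(1) show ?case by blast
  qed
  with that show thesis by blast
qed

text \<open>An exponent of at most -2 admits a single-valued primitive off the origin; the double
  \<open>Suc\<close> excludes 1/z.\<close>

lemma has_contour_integral_inverse_power:
  assumes "valid_path C" "pathfinish C = pathstart C" "0 \<notin> path_image C"
  shows "((\<lambda>z. 1 / z ^ Suc (Suc m)) has_contour_integral 0) C"
proof (rule Cauchy_theorem_primitive[where S = "- {0}" and f = "\<lambda>z. - 1 / (of_nat (Suc m) * z ^ Suc m)"])
  fix z :: complex assume "z \<in> - {0}"
  then have z: "z \<noteq> 0" by simp
  have m: "of_nat (Suc m) \<noteq> (0 :: complex)" by (simp only: of_nat_eq_0_iff)
  show "((\<lambda>z. - 1 / (of_nat (Suc m) * z ^ Suc m)) has_field_derivative 1 / z ^ Suc (Suc m)) (at z within - {0})"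
    using z m
    by (auto intro!: derivative_eq_intros simp: divide_simps simp del: of_nat_Suc power_Suc)
       (simp_all add: algebra_simps)
qed (use assms in auto)

text \<open>The residues at 0 and x cancel when both points are encircled equally often. For nonzero
  x this follows by induction on m from 1/(z (z-x)) = (1/x) (1/(z-x) - 1/z), divided by further
  powers of z; for x = 0 the poles merge into one of order m + 2.\<close>

lemma has_contour_integral_two_poles:
  assumes C: "valid_path C" "pathfinish C = pathstart C" "0 \<notin> path_image C" "x \<notin> path_image C"
    and wn: "winding_number C x = winding_number C 0"
  shows "((\<lambda>z. 1 / (z ^ Suc m * (z - x))) has_contour_integral 0) C"
proof (cases "x = 0")
  case True
  then show ?thesis
    using has_contour_integral_inverse_power[OF C(1-3), of m] by (simp add: mult.commute)
next
  case False
  show ?thesis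
  proof (induction m)
    case 0
    have "((\<lambda>z. (1 / x) * (1 / (z - x) - 1 / (z - 0))) has_contour_integral
        (1 / x) * (of_real (2 * pi) * \<i> * winding_number C x - of_real (2 * pi) * \<i> * winding_number C 0)) C"
      using C by (intro has_contour_integral_lmul has_contour_integral_diff has_contour_integral_winding_number)
    then have *: "((\<lambda>z. (1 / x) * (1 / (z - x) - 1 / (z - 0))) has_contour_integral 0) C"
      by (simp add: wn)
    show ?case
    proof (rule has_contour_integral_eq[OF *])
      fix z assume "z \<in> path_image C"
      then have "z \<noteq> 0" "z \<noteq> x" using C by auto
      then show "(1 / x) * (1 / (z - x) - 1 / (z - 0)) = 1 / (z ^ Suc 0 * (z - x))"
        using False by (simp add: divide_simps)
    qed
  next
    case (Suc m)
    have "((\<lambda>z. (1 / x) * (1 / (z ^ Suc m * (z - x)) - 1 / z ^ Suc (Suc m))) has_contour_integral (1 / x) * (0 - 0)) C"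
      using C by (intro has_contour_integral_lmul has_contour_integral_diff Suc.IH has_contour_integral_inverse_power)
    then have *: "((\<lambda>z. (1 / x) * (1 / (z ^ Suc m * (z - x)) - 1 / z ^ Suc (Suc m))) has_contour_integral 0) C"
      by simp
    show ?case
    proof (rule has_contour_integral_eq[OF *])
      fix z assume "z \<in> path_image C"
      then have "z \<noteq> 0" "z \<noteq> x" using C by auto
      then show "(1 / x) * (1 / (z ^ Suc m * (z - x)) - 1 / z ^ Suc (Suc m)) = 1 / (z ^ Suc (Suc m) * (z - x))"
        using False by (simp add: divide_simps)
    qed
  qed
qed

text \<open>After division by z^n, the Taylor part is a combination of z^(k-n)/(z-x) with k < n,
  each integrating to 0, and the remainder is g(z)/(z-x), to which Cauchy's formula applies.\<close>

lemma Cauchy_integral_taylor_remainder: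
  assumes "open D" "g holomorphic_on D" "0 \<in> D" "x \<in> D"
    and C: "valid_path C" "pathfinish C = pathstart C" "path_image C \<subseteq> D - {0, x}"
    and wn: "winding_number C 0 = 1" "winding_number C x = 1" "\<And>w. w \<notin> D \<Longrightarrow> winding_number C w = 0"
    and f: "\<And>z. f z = (\<Sum>k<n. c k * z ^ k) + z ^ n * g z"
  shows "((\<lambda>z. z powi (- int n) * f z * (1 / (z - x))) has_contour_integral 2 * of_real pi * \<i> * g x) C"
proof -
  have "((\<lambda>z. g z / (z - x)) has_contour_integral (2 * of_real pi * \<i> * winding_number C x * g x)) C"
    using Cauchy_integral_formula_global[OF assms(1,2,4) C(1) _ C(2) wn(3)] C(3) by auto
  \<comment> \<open>For k < n the exponent \<open>Suc (n - Suc k)\<close> is n - k, written as a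
    successor to match \<open>has_contour_integral_two_poles\<close>.\<close>
  moreover have "((\<lambda>z. \<Sum>k<n. c k * (1 / (z ^ Suc (n - Suc k) * (z - x)))) has_contour_integral (\<Sum>k<n. c k * 0)) C"
    using C wn by (intro has_contour_integral_sum has_contour_integral_lmul has_contour_integral_two_poles) auto
  ultimately have *: "((\<lambda>z. g z / (z - x) + (\<Sum>k<n. c k * (1 / (z ^ Suc (n - Suc k) * (z - x))))) has_contour_integral
      (2 * of_real pi * \<i> * winding_number C x * g x + (\<Sum>k<n. c k * 0))) C"
    by (rule has_contour_integral_add)
  then have *: "((\<lambda>z. g z / (z - x) + (\<Sum>k<n. c k * (1 / (z ^ Suc (n - Suc k) * (z - x))))) has_contour_integral
      2 * of_real pi * \<i> * g x) C"
    by (simp add: wn)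
  show ?thesis
  proof (rule has_contour_integral_eq[OF *])
    fix z assume "z \<in> path_image C"
    then have z: "z \<noteq> 0" "z \<noteq> x" using C by auto
    have "z ^ k / z ^ n = 1 / z ^ Suc (n - Suc k)" if "k < n" for k
    proof -
      have "z ^ n = z ^ k * z ^ (n - k)" using that by (simp flip: power_add)
      moreover have "n - k = Suc (n - Suc k)" using that by simp
      ultimately show ?thesis using z by simp
    qed
    then have "(\<Sum>k<n. c k * (1 / (z ^ Suc (n - Suc k) * (z - x)))) = (\<Sum>k<n. c k * z ^ k) / z ^ n / (z - x)"
      by (simp add: sum_divide_distrib flip: times_divide_eq_right divide_divide_eq_left del: power_Suc)
    then show "g z / (z - x) + (\<Sum>k<n. c k * (1 / (z ^ Suc (n - Suc k) * (z - x)))) =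
        z powi (- int n) * f z * (1 / (z - x))"
      using z by (simp add: f power_int_minus inverse_eq_divide add_divide_distrib del: power_Suc)
  qed
qed

section \<open>The finite part on the real side\<close>

lemma has_integral_powr_interval:
  fixes \<epsilon> a :: real
  assumes "0 < \<epsilon>" "\<epsilon> \<le> 1" "a \<noteq> 0"
  shows "((\<lambda>x. x powr (a - 1)) has_integral (1 - \<epsilon> powr a) / a) {\<epsilon>..1}"
proof -
  have "((\<lambda>x. x powr (a - 1)) has_integral 1 powr a / a - \<epsilon> powr a / a) {\<epsilon>..1}"
    using assms
    by (intro fundamental_theorem_of_calculus)
       (auto intro!: derivative_eq_intros simp flip: has_real_derivative_iff_has_vector_derivative)
  then show ?thesis by (simp add: diff_divide_distrib)
qed

text \<open>With a = alpha - n + k, the k-th Taylor term contributes a multiple of (1 - eps^a)/a: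
  the part with eps^a is exactly the counterterm, and 1/a remains for the finite sum. What is left
  has an integrable singularity, so its integral converges.\<close>

lemma has_finite_part_integral_taylor_remainder:
  assumes \<alpha>: "0 < \<alpha>" "\<alpha> < 1"
    and g: "continuous_on (complex_of_real ` {0..1}) g"
    and f: "\<And>z. f z = (\<Sum>k<n. (deriv ^^ k) f 0 / fact k * z ^ k) + z ^ n * g z"
  shows "has_finite_part_integral \<alpha> n f
     (1 / of_real \<alpha> * integral {0..1} (\<lambda>t. g (of_real (t powr (1 / \<alpha>))))
      + (\<Sum>k<n. (deriv ^^ k) f 0 / (fact k * of_real (\<alpha> - real n + real k))))"
proof -
  define G where "G = (\<lambda>t. g (of_real (t powr (1 / \<alpha>))))"
  have \<beta>: "1 / \<alpha> > 0" using \<alpha> by simp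
  have G: "continuous_on {0..1} G"
    unfolding G_def using powr_unit_interval[OF _ \<beta>]
    by (intro continuous_on_compose2[OF g] continuous_intros continuous_on_powr_unit \<beta>) auto
  \<comment> \<open>An exponent a = 0 would produce a logarithm. It cannot occur, since alpha lies
    strictly between two consecutive integers.\<close>
  have nz: "\<alpha> - real n + real k \<noteq> 0" for k
  proof
    assume "\<alpha> - real n + real k = 0"
    then have "real_of_int (int n - int k) = \<alpha>" by simp
    with \<alpha> have "0 < int n - int k \<and> int n - int k < 1" by linarith
    then show False by linarith
  qed
  \<comment> \<open>The substitution t = x^alpha absorbs the singular weight and leaves the
    continuous integrand G, with lower limit eps^alpha.\<close>
  have rem: "((\<lambda>x. of_real (x powr (\<alpha> - 1)) * g (of_real x)) has_integral
      1 / of_real \<alpha> * integral {\<epsilon> powr \<alpha>..1} G) {\<epsilon>..1}" if \<epsilon>: "0 < \<epsilon>" "\<epsilon> < 1" for \<epsilon>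
  proof -
    have "((\<lambda>x. (\<alpha> * x powr (\<alpha> - 1)) *\<^sub>R G (x powr \<alpha>)) has_integral
        integral {\<epsilon> powr \<alpha>..1 powr \<alpha>} G) {\<epsilon>..1}"
      using \<epsilon> \<alpha>
      by (intro has_integral_substitution[OF _ _ _ G])
         (auto intro!: derivative_eq_intros powr_mono2 simp: powr_le1)
    then have "((\<lambda>x. 1 / of_real \<alpha> * ((\<alpha> * x powr (\<alpha> - 1)) *\<^sub>R G (x powr \<alpha>))) has_integral
        1 / of_real \<alpha> * integral {\<epsilon> powr \<alpha>..1} G) {\<epsilon>..1}"
      by (intro has_integral_mult_right) simp
    then show ?thesis
    proof (rule has_integral_eq[rotated])
      fix x assume "x \<in> {\<epsilon>..1}"
      then have "x > 0" using \<epsilon> by simp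
      then have "G (x powr \<alpha>) = g (of_real x)"
        using \<alpha> by (simp add: G_def powr_powr)
      then show "1 / of_real \<alpha> * ((\<alpha> * x powr (\<alpha> - 1)) *\<^sub>R G (x powr \<alpha>)) =
          of_real (x powr (\<alpha> - 1)) * g (of_real x)"
        using \<alpha> by (simp add: scaleR_conv_of_real)
    qed
  qed
  \<comment> \<open>The counterterms cancel exactly for each eps in (0,1), so the only dependence on
    eps left is the lower limit of the integral of G.\<close>
  have eq: "integral {\<epsilon>..1} (\<lambda>x. of_real (x powr (\<alpha> - 1 - real n)) * f (of_real x))
      - (\<Sum>k<n. of_real (\<epsilon> powr (\<alpha> - real n + real k) / (fact k * (real n - real k - \<alpha>))) * (deriv ^^ k) f 0)
      = 1 / of_real \<alpha> * integral {\<epsilon> powr \<alpha>..1} G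
        + (\<Sum>k<n. (deriv ^^ k) f 0 / (fact k * of_real (\<alpha> - real n + real k)))"
    (is "?I - ?A = ?R + ?B") if \<epsilon>: "0 < \<epsilon>" "\<epsilon> < 1" for \<epsilon>
  proof -
    let ?T = "\<Sum>k<n. (deriv ^^ k) f 0 / fact k *
        of_real ((1 - \<epsilon> powr (\<alpha> - real n + real k)) / (\<alpha> - real n + real k))"
    have "((\<lambda>x. (\<Sum>k<n. (deriv ^^ k) f 0 / fact k * of_real (x powr (\<alpha> - real n + real k - 1)))
         + of_real (x powr (\<alpha> - 1)) * g (of_real x)) has_integral ?T + ?R) {\<epsilon>..1}"
      using \<epsilon> nz
      by (intro has_integral_add has_integral_sum has_integral_mult_right has_integral_of_real
          has_integral_powr_interval rem) auto
    then have "((\<lambda>x. of_real (x powr (\<alpha> - 1 - real n)) * f (of_real x)) has_integral ?T + ?R) {\<epsilon>..1}"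
    proof (rule has_integral_eq[rotated])
      fix x assume "x \<in> {\<epsilon>..1}"
      then have x: "x > 0" using \<epsilon> by simp
      have p: "x powr (a + real k) = x powr a * x ^ k" for a k
        using x by (simp add: powr_add powr_realpow)
      have k: "x powr (\<alpha> - real n + real k - 1) = x powr (\<alpha> - 1 - real n) * x ^ k" for k
        using p[of "\<alpha> - 1 - real n" k] by (simp add: algebra_simps)
      have n: "x powr (\<alpha> - 1) = x powr (\<alpha> - 1 - real n) * x ^ n"
        using p[of "\<alpha> - 1 - real n" n] by simp
      show "(\<Sum>k<n. (deriv ^^ k) f 0 / fact k * of_real (x powr (\<alpha> - real n + real k - 1)))
         + of_real (x powr (\<alpha> - 1)) * g (of_real x) = of_real (x powr (\<alpha> - 1 - real n)) * f (of_real x)"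
        unfolding k n f[of "of_real x"]
        by (simp add: sum_distrib_left algebra_simps)
    qed
    then have I: "?I = ?T + ?R" by (rule integral_unique)
    have "(deriv ^^ k) f 0 / fact k * of_real ((1 - \<epsilon> powr (\<alpha> - real n + real k)) / (\<alpha> - real n + real k))
        = of_real (\<epsilon> powr (\<alpha> - real n + real k) / (fact k * (real n - real k - \<alpha>))) * (deriv ^^ k) f 0
          + (deriv ^^ k) f 0 / (fact k * of_real (\<alpha> - real n + real k))" for k
    proof -
      \<comment> \<open>The counterterms have denominator n - k - alpha = -a, which accounts for the
        sign of -eps^a/a.\<close>
      have "real n - real k - \<alpha> = - (\<alpha> - real n + real k)" by simp
      then show ?thesis
        using nz[of k] by (simp only: of_real_divide of_real_mult of_real_minus of_real_diff of_real_fact of_real_1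
             mult_minus_right divide_minus_right) (simp add: divide_simps, simp add: algebra_simps)
    qed
    then have "?T = ?A + ?B" by (simp add: sum.distrib)
    with I show ?thesis by simp
  qed
  have ev: "eventually (\<lambda>\<epsilon>::real. 0 < \<epsilon> \<and> \<epsilon> < 1) (at_right 0)"
    by (rule eventually_at_rightI[of 0 1]) auto
  \<comment> \<open>The limit is continuity of the integral in its lower limit; as alpha > 0,
    eps^alpha is continuous down to eps = 0, where it is 0.\<close>
  have "continuous_on {0..1} (\<lambda>s. integral {s..1} G)"
    by (intro indefinite_integral_continuous_1' integrable_continuous_real G)
  then have "continuous_on {0..1} (\<lambda>\<epsilon>. integral {\<epsilon> powr \<alpha>..1} G)"
    by (rule continuous_on_compose2) (use continuous_on_powr_unit powr_unit_interval \<alpha> in auto)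
  then have "((\<lambda>\<epsilon>. integral {\<epsilon> powr \<alpha>..1} G) \<longlongrightarrow> integral {0 powr \<alpha>..1} G) (at 0 within {0..1})"
    unfolding continuous_on_def by (rule bspec) simp
  then have "((\<lambda>\<epsilon>. integral {\<epsilon> powr \<alpha>..1} G) \<longlongrightarrow> integral {0..1} G) (at_right 0)"
    by (simp add: at_within_Icc_at_right)
  then have "((\<lambda>\<epsilon>. 1 / of_real \<alpha> * integral {\<epsilon> powr \<alpha>..1} G
        + (\<Sum>k<n. (deriv ^^ k) f 0 / (fact k * of_real (\<alpha> - real n + real k)))) \<longlongrightarrow>
      1 / of_real \<alpha> * integral {0..1} G
        + (\<Sum>k<n. (deriv ^^ k) f 0 / (fact k * of_real (\<alpha> - real n + real k)))) (at_right 0)"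
    by (intro tendsto_intros)
  then show ?thesis
    unfolding has_finite_part_integral_def G_def[symmetric]
    by (rule Lim_transform_eventually) (use ev in eventually_elim, use eq in simp)
qed

section \<open>The contour side and the conclusion\<close>

text \<open>With Psi written as an integral over t and the integrations interchanged, the inner
  contour integral has its poles at 0 and x = t^(1/alpha), both in [0,1] and encircled once, and
  equals 2 pi i g(x).\<close>

lemma contour_integral_Psi:
  assumes \<alpha>: "0 < \<alpha>" and "open D" and sub: "complex_of_real ` {0..1} \<subseteq> D"
    and g: "g holomorphic_on D" and f: "f holomorphic_on D"
    and C: "valid_path C" "pathfinish C = pathstart C" "path_image C \<subseteq> D - complex_of_real ` {0..1}"
    and wn: "\<And>w. w \<in> complex_of_real ` {0..1} \<Longrightarrow> winding_number C w = 1"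
      "\<And>w. w \<notin> D \<Longrightarrow> winding_number C w = 0"
    and fg: "\<And>z. f z = (\<Sum>k<n. c k * z ^ k) + z ^ n * g z"
  shows "contour_integral C (\<lambda>z. z powi (- int n) * f z * Psi \<alpha> z) =
     2 * of_real pi * \<i> * (1 / of_real \<alpha> * integral {0..1} (\<lambda>t. g (of_real (t powr (1 / \<alpha>)))))"
proof -
  define S where "S = D - complex_of_real ` {0..1}"
  define k where "k = (\<lambda>z t. z powi (- int n) * f z * (1 / (z - complex_of_real (t powr (1 / \<alpha>)))))"
  have \<beta>: "1 / \<alpha> > 0" using \<alpha> by simp
  have x: "complex_of_real (t powr (1 / \<alpha>)) \<in> complex_of_real ` {0..1}" if "t \<in> {0..1}" for t
    using powr_unit_interval[OF that \<beta>] by blast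
  have zero: "0 \<in> complex_of_real ` {0..1}" by force
  have nz: "z \<noteq> 0" "t \<in> {0..1} \<Longrightarrow> z - complex_of_real (t powr (1 / \<alpha>)) \<noteq> 0" if "z \<in> S" for z t
    using that zero x[of t] by (auto simp: S_def)
  have "compact (complex_of_real ` {0..1})"
    by (intro compact_continuous_image continuous_intros) auto
  then have S: "open S" unfolding S_def using \<open>open D\<close> by (intro open_Diff compact_imp_closed)
  have fS: "f holomorphic_on S" using f by (rule holomorphic_on_subset) (auto simp: S_def)
  have pre: "(\<lambda>z. z powi (- int n) * f z) holomorphic_on S"
    using nz by (intro holomorphic_intros fS) auto
  have Psi: "z powi (- int n) * f z * Psi \<alpha> z = 1 / of_real \<alpha> * integral {0..1} (k z)" if "z \<in> S" for z
    using that unfolding k_def by (simp only: integral_mult_right) (simp add: S_def Psi_eq_integral \<alpha>)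
  \<comment> \<open>The inner integral is alpha times a function already known to be holomorphic on
    S, so its holomorphy is inherited from \<open>Psi\<close>.\<close>
  have "(\<lambda>z. of_real \<alpha> * (z powi (- int n) * f z * Psi \<alpha> z)) holomorphic_on S"
    by (intro holomorphic_intros pre holomorphic_on_subset[OF Psi_holomorphic[OF \<alpha>]]) (auto simp: S_def)
  then have holI: "(\<lambda>z. integral {0..1} (k z)) holomorphic_on S"
    by (rule holomorphic_transform) (use \<alpha> Psi in simp)
  have c: "continuous_on (S \<times> {0..1}) (\<lambda>y. snd y powr (1 / \<alpha>))"
    by (rule continuous_on_compose2[OF continuous_on_powr_unit[OF \<beta>]]) (auto intro: continuous_intros)
  have c': "continuous_on (S \<times> {0..1::real}) (\<lambda>y. fst y powi (- int n) * f (fst y))"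
    by (rule continuous_on_compose2[OF holomorphic_on_imp_continuous_on[OF pre]]) (auto intro: continuous_intros)
  have "contour_integral C (\<lambda>z. z powi (- int n) * f z * Psi \<alpha> z) =
        contour_integral C (\<lambda>z. 1 / of_real \<alpha> * integral {0..1} (k z))"
    using C(3) Psi by (intro contour_integral_eq) (auto simp: S_def)
  also have "\<dots> = 1 / of_real \<alpha> * contour_integral C (\<lambda>z. integral {0..1} (k z))"
    using holI C S by (intro contour_integral_lmul contour_integrable_holomorphic_simple[of _ S]) (auto simp: S_def)
  also have "contour_integral C (\<lambda>z. integral {0..1} (k z)) = integral {0..1} (\<lambda>t. contour_integral C (\<lambda>z. k z t))"
  proof (rule contour_integral_integral_swap[OF S C(1,2) _ _ _ holI])
    show "continuous_on (S \<times> {0..1}) (\<lambda>(z, t). k z t)"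
      unfolding k_def split_beta using nz by (intro continuous_intros c c') auto
    show "(\<lambda>z. k z t) holomorphic_on S" if "t \<in> {0..1}" for t
      unfolding k_def using nz that by (intro holomorphic_on_mult[OF pre] holomorphic_intros) auto
  qed (use C in \<open>simp add: S_def\<close>)
  also have "\<dots> = integral {0..1} (\<lambda>t. 2 * of_real pi * \<i> * g (of_real (t powr (1 / \<alpha>))))"
  proof (rule integral_cong)
    fix t :: real assume t: "t \<in> {0..1}"
    show "contour_integral C (\<lambda>z. k z t) = 2 * of_real pi * \<i> * g (of_real (t powr (1 / \<alpha>)))"
      unfolding k_def using C x[OF t] zero sub
      by (intro contour_integral_unique Cauchy_integral_taylor_remainder[OF \<open>open D\<close> g _ _ C(1,2) _ _ _ wn(2) fg] wn)
         auto
  qed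
  finally show ?thesis by simp
qed

theorem theorem1:
  fixes \<alpha> :: real and n :: nat and f :: "complex \<Rightarrow> complex"
    and D :: "complex set" and C :: "real \<Rightarrow> complex"
  assumes "0 < \<alpha>" and "\<alpha> < 1" and "n \<ge> 1"
    and "open D" and "connected D" and "complex_of_real ` {0..1} \<subseteq> D"
    and "f holomorphic_on D"
    and "valid_path C" and "pathfinish C = pathstart C"
    and "path_image C \<subseteq> D - complex_of_real ` {0..1}"
    and "\<forall>w \<in> complex_of_real ` {0..1}. winding_number C w = 1"
    and "\<forall>w. w \<notin> D \<longrightarrow> winding_number C w = 0"
  shows "has_finite_part_integral \<alpha> n f (finite_part_integral \<alpha> n f) \<and>
         finite_part_integral \<alpha> n f =
           1 / (2 * of_real pi * \<i>)
             * contour_integral C (\<lambda>z. z powi (- int n) * f z * Psi \<alpha> z)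
           + (\<Sum>k<n. (deriv ^^ k) f 0 / (fact k * of_real (\<alpha> - real n + real k)))"


proof -
  have zero: "0 \<in> complex_of_real ` {0..1}" by force
  then have "0 \<in> D" using assms by blast
  then obtain g where g: "g holomorphic_on D"
      "\<And>z. f z = (\<Sum>k<n. (deriv ^^ k) f 0 / fact k * z ^ k) + z ^ n * g z"
    using holomorphic_taylor_remainder[OF \<open>f holomorphic_on D\<close> \<open>open D\<close>, where n = n] by blast
  \<comment> \<open>After x = t^(1/alpha) this is the integral of x^(alpha-1) g(x) over [0,1], the
    quantity through which the real side and the contour side are compared.\<close>
  let ?R = "1 / of_real \<alpha> * integral {0..1} (\<lambda>t. g (of_real (t powr (1 / \<alpha>))))"
  have fp: "has_finite_part_integral \<alpha> n f
      (?R + (\<Sum>k<n. (deriv ^^ k) f 0 / (fact k * of_real (\<alpha> - real n + real k))))"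
    using assms
    by (intro has_finite_part_integral_taylor_remainder[OF _ _ _ g(2)]
        continuous_on_subset[OF holomorphic_on_imp_continuous_on[OF g(1)]])
  have "contour_integral C (\<lambda>z. z powi (- int n) * f z * Psi \<alpha> z) = 2 * of_real pi * \<i> * ?R"
    using assms by (intro contour_integral_Psi[OF _ _ _ g(1) _ _ _ _ _ _ g(2)]) auto
  then have "1 / (2 * of_real pi * \<i>) * contour_integral C (\<lambda>z. z powi (- int n) * f z * Psi \<alpha> z) = ?R"
    by simp
  with fp finite_part_integral_eqI[OF fp] show ?thesis by simp
qed

end
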